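(* In the setting fixed in the context (1-2 junction problem, under the assumptions listed there on the data, on the flux limiter and on the table of games), there exists $\mathbf F_1\in\mathcal B^3$ which is a mild kinetic solution across the 1-2 junction.
   Context: Fixed quantities: $T>0$; an integer $n\ge 2$; speeds $0=v_1<v_2<\dots<v_n=1$; $a\in[0,1]$ (flux distribution coefficient); $\eta_0>0$. Put $\delta^c_{1j}=0$ if $j=1$ and $\delta^c_{1j}=1$ if $j\ge2$. Function spaces. $X_T=C([0,T];\mathbb R^n)$ and $$\mathcal B=\Big\{\mathbf u\in X_T:\ 0\le u_j(t)\le1,\ \sum_{j=1}^n u_j(t)\le 1\ \ \forall j=1,\dots,n,\ \forall t\in[0,T]\Big\}.$$ A constant vector is regarded as a constant function when membership in $\mathcal B$ is asserted. $\mathcal B^3=\mathcal B\times\mathcal B\times\mathcal B$. Table of games. For $h,k,j\in\{1,\dots,n\}$ and $\rho\in[0,1]$, $A^j_{hk}[\rho]\geq 0$ are given probabilities with $\sum_{j=1}^nA^j_{hk}[\rho]=1$ for all $h,k,\rho$, and each $\rho\mapsto A^j_{hk}[\rho]$ is Lipschitz continuous on $[0,1]$. For $\mathbf f=(f_1,\dots,f_n)$ with $\rho=\sum_{j}f_j$, $$G_j[\mathbf f,\mathbf f]=\eta_0\,\rho\sum_{h,k=1}^nA^j_{hk}[\rho]f_hf_k,\qquad L[\mathbf f]=\eta_0\,\rho^2 .$$ Flux limiter. $\Phi:[0,1]^2\to[0,1]$ satisfies: (i) $0\le\Phi(u,v)\le1$ for all $u,v\in[0,1]$; (ii) $\Phi(u,v)u\le1-v$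 for all $(u,v)\in[0,1]^2$ with $u+v>1$; (iii) there is $\mathrm{Lip}(\Phi)>0$ with $|\Phi(u_2,v_2)-\Phi(u_1,v_1)|\le\mathrm{Lip}(\Phi)(|u_2-u_1|+|v_2-v_1|)$ for all $(u_1,v_1),(u_2,v_2)\in[0,1]^2$. Data. The initial and boundary data are $\{\{\boldsymbol\varphi^r\}_{r=1}^3,\bar{\mathbf f}^1,\{\bar\Phi^r\}_{r=1}^3\}$, where $\boldsymbol\varphi^r=(\varphi^r_1,\dots,\varphi^r_n)\in\mathcal B$ are constant vectors (initial data), $\bar{\mathbf f}^1=(\bar f^1_1,\dots,\bar f^1_n)\in\mathcal B$, $\bar\Phi^2,\bar\Phi^3$ are prescribed (known) flux limiters at the ends of roads 2 and 3, i.e. prescribed functions of time with values in $[0,1]$, and $\bar\Phi^1(t)=\Phi(\bar\rho^1(t),\rho^1_1(t))$ with $\bar\rho^1=\sum_{j}\bar f^1_j$ and $\rho^1_1=\sum_jf^1_{1j}$ the density on road 1 of the solution itself. Mild solution. A function $\mathbf F_1=(\mathbf f^1_1,\mathbf f^2_1,\mathbf f^3_1):[0,T]\to\mathbb R^n\times\mathbb R^n\times\mathbb R^n$, $\mathbf f^r_1=(f^r_{1j})_{j=1}^n$, is a mild kinetic solution across the 1-2 junction if $\mathbf F_1\in\mathcal B^3$ and for all $t\in[0,T]$, $j=1,\dots,n$, $$f^1_{1j}(t)=\varphi^1_j+\int_0^t\Big\{v_j\big(\bar\Phi^1\bar f^1_j-(a\Phi^2_{0,1}+(1-a)\Phi^3_{0,1})f^1_{1j}\big)+G_j[\mathbf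 f^1_1,\mathbf f^1_1]-f^1_{1j}L[\mathbf f^1_1]\Big\}ds,$$ $$f^2_{1j}(t)=\varphi^2_j+\int_0^t\Big\{v_j\big(a\Phi^2_{0,1}f^1_{1j}\delta^c_{1j}-\bar\Phi^2f^2_{1j}\big)+G_j[\mathbf f^2_1,\mathbf f^2_1]-f^2_{1j}L[\mathbf f^2_1]\Big\}ds,$$ $$f^3_{1j}(t)=\varphi^3_j+\int_0^t\Big\{v_j\big((1-a)\Phi^3_{0,1}f^1_{1j}\delta^c_{1j}-\bar\Phi^3f^3_{1j}\big)+G_j[\mathbf f^3_1,\mathbf f^3_1]-f^3_{1j}L[\mathbf f^3_1]\Big\}ds,$$ all functions in the integrands being evaluated at time $s$, where $\Phi^r_{0,1}=\Phi(\rho^r_0,\rho^r_1)$ for $r=2,3$, $\rho^r_1=\sum_{j=1}^nf^r_{1j}$, $\rho^2_0=a\sum_{j=2}^nf^1_{1j}$ and $\rho^3_0=(1-a)\sum_{j=2}^nf^1_{1j}$. *)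

theory Defs
  imports "HOL-Analysis.Analysis"
begin

text \<open>
  The speed classes \<open>1, \<dots>, n\<close> are the elements of a finite linearly ordered type \<open>'n\<close>;
  every \<open>n\<close> is realised by some such type (e.g. the numeral types).  The index \<open>1\<close> is
  \<open>Min UNIV\<close>, the index \<open>n\<close> is \<open>Max UNIV\<close>, and \<open>n\<close> itself is \<open>CARD('n)\<close>.
\<close>

abbreviation first_class :: "'n::{finite,linorder}" where
  "first_class \<equiv> Min UNIV"

abbreviation last_class :: "'n::{finite,linorder}" where
  "last_class \<equiv> Max UNIV"

definition \<delta>c :: "'n::{finite,linorder} \<Rightarrow> real" where
  "\<delta>c j = (if j = first_class then 0 else 1)"

definition density :: "real^'n::finite \<Rightarrow> real" where
  "density f = (\<Sum>j\<in>UNIV. f $ j)"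

text \<open>Elements of \<open>C([0,T]; \<real>\<^sup>n)\<close> are total functions whose values outside \<open>[0,T]\<close> are
  irrelevant.\<close>

definition X_space :: "real \<Rightarrow> (real \<Rightarrow> real^'n::finite) set" where
  "X_space T = {u. continuous_on {0..T} u}"

definition B_set :: "real \<Rightarrow> (real \<Rightarrow> real^'n::finite) set" where
  "B_set T = {u \<in> X_space T. \<forall>t\<in>{0..T}.
     (\<forall>j. 0 \<le> u t $ j \<and> u t $ j \<le> 1) \<and> (\<Sum>j\<in>UNIV. u t $ j) \<le> 1}"

text \<open>\<open>A h k j \<rho>\<close> stands for \<open>A\<^sup>j\<^sub>h\<^sub>k[\<rho>]\<close>.\<close>

definition table_of_games ::
  "('n::finite \<Rightarrow> 'n \<Rightarrow> 'n \<Rightarrow> real \<Rightarrow> real) \<Rightarrow> bool" where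
  "table_of_games A \<longleftrightarrow>
     (\<forall>h k j. \<forall>\<rho>\<in>{0..1}. 0 \<le> A h k j \<rho>) \<and>
     (\<forall>h k. \<forall>\<rho>\<in>{0..1}. (\<Sum>j\<in>UNIV. A h k j \<rho>) = 1) \<and>
     (\<forall>h k j. \<exists>K. K-lipschitz_on {0..1} (A h k j))"

definition gain ::
  "real \<Rightarrow> ('n::finite \<Rightarrow> 'n \<Rightarrow> 'n \<Rightarrow> real \<Rightarrow> real) \<Rightarrow> 'n \<Rightarrow> real^'n \<Rightarrow> real" where
  "gain \<eta>0 A j f =
     \<eta>0 * density f * (\<Sum>h\<in>UNIV. \<Sum>k\<in>UNIV. A h k j (density f) * f $ h * f $ k)"

definition loss :: "real \<Rightarrow> real^'n::finite \<Rightarrow> real" where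
  "loss \<eta>0 f = \<eta>0 * (density f)\<^sup>2"

definition flux_limiter :: "(real \<Rightarrow> real \<Rightarrow> real) \<Rightarrow> bool" where
  "flux_limiter \<Phi> \<longleftrightarrow>
     (\<forall>u\<in>{0..1}. \<forall>v\<in>{0..1}. 0 \<le> \<Phi> u v \<and> \<Phi> u v \<le> 1) \<and>
     (\<forall>u\<in>{0..1}. \<forall>v\<in>{0..1}. u + v > 1 \<longrightarrow> \<Phi> u v * u \<le> 1 - v) \<and>
     (\<exists>K>0. \<forall>u1\<in>{0..1}. \<forall>v1\<in>{0..1}. \<forall>u2\<in>{0..1}. \<forall>v2\<in>{0..1}.
        \<bar>\<Phi> u2 v2 - \<Phi> u1 v1\<bar> \<le> K * (\<bar>u2 - u1\<bar> + \<bar>v2 - v1\<bar>))"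

text \<open>\<open>\<Phi>\<^sup>2\<^sub>0\<^sub>1 = \<Phi>(\<rho>\<^sup>2\<^sub>0, \<rho>\<^sup>2\<^sub>1)\<close> is \<open>junction_limiter \<Phi> a f1 f2\<close> and
  \<open>\<Phi>\<^sup>3\<^sub>0\<^sub>1 = \<Phi>(\<rho>\<^sup>3\<^sub>0, \<rho>\<^sup>3\<^sub>1)\<close> is \<open>junction_limiter \<Phi> (1 - a) f1 f3\<close>; the first argument
  of \<open>\<Phi>\<close> omits the resting class.\<close>

definition junction_limiter ::
  "(real \<Rightarrow> real \<Rightarrow> real) \<Rightarrow> real \<Rightarrow> real^'n::{finite,linorder} \<Rightarrow> real^'n::{finite,linorder} \<Rightarrow> real" where
  "junction_limiter \<Phi> c f g = \<Phi> (c * (\<Sum>j\<in>UNIV - {first_class}. f $ j)) (density g)"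

text \<open>Right-hand sides on the incoming road, and on an outgoing road that receives the
  fraction \<open>c\<close> of the flux (\<open>c = a\<close> on road 2, \<open>c = 1 - a\<close> on road 3).  All arguments are
  values at one instant; \<open>f1b\<close> is the boundary value and \<open>\<Phi>b\<close> the limiter at the far end.\<close>

definition rhs_in ::
  "('n::{finite,linorder} \<Rightarrow> real) \<Rightarrow> real \<Rightarrow> real \<Rightarrow> ('n \<Rightarrow> 'n \<Rightarrow> 'n \<Rightarrow> real \<Rightarrow> real)
   \<Rightarrow> (real \<Rightarrow> real \<Rightarrow> real) \<Rightarrow> real^'n::{finite,linorder} \<Rightarrow> real^'n::{finite,linorder}
   \<Rightarrow> real^'n::{finite,linorder} \<Rightarrow> real^'n::{finite,linorder} \<Rightarrow> 'n \<Rightarrow> real" where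
  "rhs_in v a \<eta>0 A \<Phi> f1b f1 f2 f3 j =
     v j * (\<Phi> (density f1b) (density f1) * f1b $ j
            - (a * junction_limiter \<Phi> a f1 f2
               + (1 - a) * junction_limiter \<Phi> (1 - a) f1 f3) * f1 $ j)
     + gain \<eta>0 A j f1 - f1 $ j * loss \<eta>0 f1"

definition rhs_out ::
  "('n::{finite,linorder} \<Rightarrow> real) \<Rightarrow> real \<Rightarrow> real \<Rightarrow> ('n \<Rightarrow> 'n \<Rightarrow> 'n \<Rightarrow> real \<Rightarrow> real)
   \<Rightarrow> (real \<Rightarrow> real \<Rightarrow> real) \<Rightarrow> real \<Rightarrow> real^'n::{finite,linorder} \<Rightarrow> real^'n::{finite,linorder}
   \<Rightarrow> 'n \<Rightarrow> real" where
  "rhs_out v c \<eta>0 A \<Phi> \<Phi>b f1 g j =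
     v j * (c * junction_limiter \<Phi> c f1 g * f1 $ j * \<delta>c j - \<Phi>b * g $ j)
     + gain \<eta>0 A j g - g $ j * loss \<eta>0 g"

text \<open>\<open>u = u\<^sub>0 + \<integral>\<^sub>0\<^sup>t q ds\<close>, including the (Lebesgue) integrability of \<open>q\<close>.\<close>

definition integral_equation :: "real \<Rightarrow> real \<Rightarrow> (real \<Rightarrow> real) \<Rightarrow> (real \<Rightarrow> real) \<Rightarrow> bool" where
  "integral_equation T u0 q u \<longleftrightarrow>
     (\<forall>t\<in>{0..T}. set_integrable lebesgue {0..t} q \<and>
        u t = u0 + (LINT s:{0..t}|lebesgue. q s))"

definition mild_kinetic_solution ::
  "real \<Rightarrow> ('n::{finite,linorder} \<Rightarrow> real) \<Rightarrow> real \<Rightarrow> real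
   \<Rightarrow> ('n \<Rightarrow> 'n \<Rightarrow> 'n \<Rightarrow> real \<Rightarrow> real) \<Rightarrow> (real \<Rightarrow> real \<Rightarrow> real)
   \<Rightarrow> real^'n::{finite,linorder} \<Rightarrow> real^'n::{finite,linorder} \<Rightarrow> real^'n::{finite,linorder}
   \<Rightarrow> (real \<Rightarrow> real^'n::{finite,linorder}) \<Rightarrow> (real \<Rightarrow> real) \<Rightarrow> (real \<Rightarrow> real)
   \<Rightarrow> (real \<Rightarrow> real^'n::{finite,linorder}) \<times> (real \<Rightarrow> real^'n::{finite,linorder})
      \<times> (real \<Rightarrow> real^'n::{finite,linorder})
   \<Rightarrow> bool" where
  "mild_kinetic_solution T v a \<eta>0 A \<Phi> \<phi>1 \<phi>2 \<phi>3 f1b \<Phi>b2 \<Phi>b3 F \<longleftrightarrow>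
     F \<in> B_set T \<times> B_set T \<times> B_set T \<and>
     (case F of (f1, f2, f3) \<Rightarrow> \<forall>j.
        integral_equation T (\<phi>1 $ j)
          (\<lambda>s. rhs_in v a \<eta>0 A \<Phi> (f1b s) (f1 s) (f2 s) (f3 s) j) (\<lambda>t. f1 t $ j) \<and>
        integral_equation T (\<phi>2 $ j)
          (\<lambda>s. rhs_out v a \<eta>0 A \<Phi> (\<Phi>b2 s) (f1 s) (f2 s) j) (\<lambda>t. f2 t $ j) \<and>
        integral_equation T (\<phi>3 $ j)
          (\<lambda>s. rhs_out v (1 - a) \<eta>0 A \<Phi> (\<Phi>b3 s) (f1 s) (f3 s) j) (\<lambda>t. f3 t $ j))"

end

theory Submission
  imports Defs
begin

text \<open>
  Let \<open>K\<close> be the set of triples of nonnegative vectors of density at most 1.  The right-hand side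
  \<open>g\<close> is Lipschitz in the state on the compact convex set \<open>K\<close>, and \<open>x + g/(1 + \<eta>0) \<in> K\<close> for
  \<open>x \<in> K\<close>: the outflow and loss terms of class \<open>j\<close> are at most \<open>(1 + \<eta>0) f\<^sub>j\<close>, gain and loss
  cancel in the density, and the flux limiter bounds the inflow by \<open>1 - \<rho>\<close>.  With \<open>P\<close> the
  projection onto \<open>K\<close>, the equation for \<open>g(s, P u) + (1 + \<eta>0)(P u - u)\<close> is globally Lipschitz and
  hence solvable on \<open>[0,T]\<close>; this field points towards \<open>K\<close>, so its solution never leaves any
  halfspace containing \<open>K\<close>, stays in \<open>K\<close>, and solves the original equation.
\<close>

section \<open>Global solvability of integral equations with measurable time dependence\<close>

text \<open>The Picard operator contracts the norm \<open>sup exp(-\<mu> t) |u t|\<close> once \<open>\<mu>\<close> exceeds the Lipschitz constant,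
  so the fixed point lives on all of \<open>[0,T]\<close>.\<close>

lemma caratheodory_picard:
  fixes G :: "real \<Rightarrow> 'a::euclidean_space \<Rightarrow> 'a"
  assumes T: "0 \<le> T"
    and meas: "\<And>u. continuous_on {0..T} u \<Longrightarrow> (\<lambda>s. G s (u s)) \<in> borel_measurable (lebesgue_on {0..T})"
    and lip: "\<And>s. s \<in> {0..T} \<Longrightarrow> L-lipschitz_on UNIV (G s)"
    and bnd: "\<And>s. s \<in> {0..T} \<Longrightarrow> norm (G s 0) \<le> M"
  obtains u where "continuous_on {0..T} u" "(\<lambda>s. G s (u s)) absolutely_integrable_on {0..T}"
    "\<And>t. t \<in> {0..T} \<Longrightarrow> u t = u0 + integral {0..t} (\<lambda>s. G s (u s))"
proof -
  have L: "0 \<le> L"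
    using lip[of 0] T lipschitz_on_nonneg by auto
  \<comment> \<open>The added one keeps \<open>\<mu>\<close> positive even when
    \<open>L = 0\<close>, so \<open>L / \<mu> < 1\<close> in every case.\<close>
  define \<mu> where "\<mu> = 2 * L + 1"
  have \<mu>: "\<mu> > 0" "L / \<mu> < 1"
    using L by (auto simp: \<mu>_def)
  have absint: "(\<lambda>s. G s (u s)) absolutely_integrable_on {0..T}" if u: "continuous_on {0..T} u" for u
  proof (rule measurable_bounded_by_integrable_imp_absolutely_integrable)
    show "(\<lambda>s. M + L * norm (u s)) integrable_on {0..T}"
      by (intro integrable_continuous_interval continuous_intros u)
    show "norm (G s (u s)) \<le> M + L * norm (u s)" if "s \<in> {0..T}" for s
      using lipschitz_on_normD[OF lip[OF that], of "u s" 0] bnd[OF that]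
        norm_triangle_ineq2[of "G s (u s)" "G s 0"] by simp
  qed (use meas[OF u] in auto)
  \<comment> \<open>The unknown is \<open>w t = exp (- \<mu> * t) *\<^sub>R u t\<close>, and
    \<open>E\<close> undoes the weight. The weighted norm of \<open>u\<close> thus becomes the plain
    sup norm of \<open>w\<close>, for which bounded continuous functions form a complete
    space.\<close>
  define E where "E w s = exp (\<mu> * s) *\<^sub>R apply_bcontfun w s" for w :: "real \<Rightarrow>\<^sub>C 'a" and s
  have E: "continuous_on {0..T} (E w)" for w
    unfolding E_def
    by (intro continuous_intros continuous_on_subset[OF continuous_on_apply_bcontfun]) auto
  have int: "(\<lambda>s. G s (E w s)) integrable_on {0..t}" if "t \<in> {0..T}" for w t
    using absolutely_integrable_on_subinterval[OF absint[OF E], of 0 t] that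
      set_lebesgue_integral_eq_integral(1) by auto
  define F where "F w t = exp (- \<mu> * t) *\<^sub>R (u0 + integral {0..t} (\<lambda>s. G s (E w s)))" for w t
  have F: "continuous_on {0..T} (F w)" for w
    unfolding F_def using T
    by (intro continuous_intros indefinite_integral_continuous_1 int) auto
  \<comment> \<open>Elements of the space live on the whole real line. Outside the interval
    \<open>clamp\<close> freezes the image at its endpoint values, so a bound on
    \<open>{0..T}\<close> is a bound everywhere.\<close>
  have "\<exists>w'. \<forall>x. apply_bcontfun w' x = F w (clamp 0 T x)" for w
    using continuous_on_cbox_bcontfunE[of 0 T "F w"] F[of w] by (metis cbox_interval)
  then obtain \<Gamma> where \<Gamma>: "\<And>w x. apply_bcontfun (\<Gamma> w) x = F w (clamp 0 T x)"
    by metis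
  have F_dist: "dist (F w t) (F w' t) \<le> L / \<mu> * dist w w'" if t: "t \<in> {0..T}" for w w' t
  proof -
    have sub: "{0..t} \<subseteq> {0..T}"
      using t by auto
    have "((\<lambda>s. exp (\<mu> * s)) has_integral exp (\<mu> * t) / \<mu> - exp (\<mu> * 0) / \<mu>) {0..t}"
      using t \<mu>(1) by (intro fundamental_theorem_of_calculus)
        (auto intro!: derivative_eq_intros simp flip: has_real_derivative_iff_has_vector_derivative)
    from has_integral_mult_right[OF this, of "L * dist w w'"]
    have exp_int: "((\<lambda>s. L * dist w w' * exp (\<mu> * s)) has_integral
        L * dist w w' * (exp (\<mu> * t) / \<mu> - 1 / \<mu>)) {0..t}"
      by simp
    have "norm (integral {0..t} (\<lambda>s. G s (E w s) - G s (E w' s)))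
        \<le> integral {0..t} (\<lambda>s. L * dist w w' * exp (\<mu> * s))"
    proof (rule integral_norm_bound_integral)
      show "(\<lambda>s. G s (E w s) - G s (E w' s)) integrable_on {0..t}"
        by (intro integrable_diff int t)
      show "(\<lambda>s. L * dist w w' * exp (\<mu> * s)) integrable_on {0..t}"
        using exp_int by blast
      fix s assume s: "s \<in> {0..t}"
      have "norm (E w s - E w' s) = exp (\<mu> * s) * dist (apply_bcontfun w s) (apply_bcontfun w' s)"
        by (simp add: E_def dist_norm flip: scaleR_diff_right)
      also have "\<dots> \<le> exp (\<mu> * s) * dist w w'"
        by (intro mult_left_mono dist_bounded) auto
      finally have "L * norm (E w s - E w' s) \<le> L * (exp (\<mu> * s) * dist w w')"
        using L by (rule mult_left_mono)
      moreover have "norm (G s (E w s) - G s (E w' s)) \<le> L * norm (E w s - E w' s)"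
        using lipschitz_on_normD[OF lip] s sub by blast
      ultimately show "norm (G s (E w s) - G s (E w' s)) \<le> L * dist w w' * exp (\<mu> * s)"
        by (simp add: ac_simps)
    qed
    also have "\<dots> = L * dist w w' * (exp (\<mu> * t) / \<mu> - 1 / \<mu>)"
      using exp_int by (rule integral_unique)
    \<comment> \<open>After the lower endpoint term is dropped, the exponential cancels against the
      weight in \<open>F\<close>, so the contraction factor \<open>L / \<mu>\<close> depends neither
      on \<open>t\<close> nor on \<open>T\<close>.\<close>
    also have "\<dots> \<le> L * dist w w' * (exp (\<mu> * t) / \<mu>)"
      using L \<mu>(1) by (intro mult_left_mono) auto
    finally have bound: "norm (integral {0..t} (\<lambda>s. G s (E w s) - G s (E w' s)))
        \<le> L * dist w w' * (exp (\<mu> * t) / \<mu>)" .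
    have "dist (F w t) (F w' t) = exp (- \<mu> * t) * norm (integral {0..t} (\<lambda>s. G s (E w s) - G s (E w' s)))"
      unfolding F_def dist_norm using int[OF t]
      by (simp add: integral_diff flip: scaleR_diff_right)
    also have "\<dots> \<le> exp (- \<mu> * t) * (L * dist w w' * (exp (\<mu> * t) / \<mu>))"
      by (intro mult_left_mono bound) auto
    also have "\<dots> = L / \<mu> * dist w w'"
      by (simp add: exp_minus field_simps)
    finally show ?thesis .
  qed
  have "\<forall>w w'. dist (\<Gamma> w) (\<Gamma> w') \<le> L / \<mu> * dist w w'"
  proof (intro allI dist_bound)
    fix w w' x
    have "clamp 0 T x \<in> {0..T}"
      using clamp_in_interval[of 0 T x] T unfolding cbox_interval by simp
    then show "dist (apply_bcontfun (\<Gamma> w) x) (apply_bcontfun (\<Gamma> w') x) \<le> L / \<mu> * dist w w'"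
      unfolding \<Gamma> by (rule F_dist)
  qed
  then obtain w where w: "\<Gamma> w = w"
    using banach_fix_type[of "L / \<mu>" \<Gamma>] \<mu> L by auto
  show ?thesis
  proof
    show "continuous_on {0..T} (E w)"
      by (rule E)
    then show "(\<lambda>s. G s (E w s)) absolutely_integrable_on {0..T}"
      by (rule absint)
    fix t assume t: "t \<in> {0..T}"
    then have "apply_bcontfun w t = F w t"
      using \<Gamma>[of w t] w by (simp add: clamp_cancel_cbox)
    then show "E w t = u0 + integral {0..t} (\<lambda>s. G s (E w s))"
      unfolding E_def[of w t] by (simp add: F_def exp_minus)
  qed
qed

section \<open>Invariance of compact convex sets\<close>

text \<open>The last time before \<open>t\<close> at which \<open>y\<close> is nonpositive starts an interval on which \<open>y\<close> has
  nonpositive derivative.\<close>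

lemma nonpos_if_decreasing_where_positive:
  fixes y q :: "real \<Rightarrow> real"
  assumes cont: "continuous_on {0..T} y"
    and q: "q integrable_on {0..T}"
    and eq: "\<And>t. t \<in> {0..T} \<Longrightarrow> y t = y0 + integral {0..t} q"
    and y0: "y0 \<le> 0"
    and decr: "\<And>s. s \<in> {0..T} \<Longrightarrow> y s > 0 \<Longrightarrow> q s \<le> 0"
    and t: "t \<in> {0..T}"
  shows "y t \<le> 0"
proof (rule ccontr)
  assume "\<not> y t \<le> 0"
  define Z where "Z = {s \<in> {0..t}. y s \<le> 0}"
  have sub: "{0..t} \<subseteq> {0..T}"
    using t by auto
  have "compact Z"
  proof -
    have "closed ({0..t} \<inter> y -` {..0})"
      by (rule continuous_closed_preimage[OF continuous_on_subset[OF cont sub]]) simp_all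
    moreover have "Z = {0..t} \<inter> y -` {..0}"
      by (auto simp: Z_def)
    ultimately have "closed Z"
      by simp
    moreover have "bounded Z"
      by (rule bounded_subset[of "{0..t}"]) (auto simp: Z_def)
    ultimately show ?thesis
      by (simp add: compact_eq_bounded_closed)
  qed
  moreover have "0 \<in> Z"
    using eq[of 0] t y0 by (auto simp: Z_def)
  ultimately obtain r where r: "r \<in> Z" and max: "\<forall>s\<in>Z. s \<le> r"
    using compact_attains_sup[of Z] by fast
  have rt: "0 \<le> r" "r \<le> t" "y r \<le> 0"
    using r by (auto simp: Z_def)
  have "integral {r..t} q \<le> 0"
  proof -
    \<comment> \<open>The sign of \<open>q\<close> is known only where \<open>y\<close> is positive,
      which excludes \<open>r\<close>. Overwriting that single value leaves the integral
      unchanged.\<close>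
    define q' where "q' = q(r := 0)"
    have q': "q' s = q s" if "s \<in> {r..t} - {r}" for s
      using that by (simp add: q'_def)
    have "q integrable_on {r..t}"
      by (rule integrable_on_subinterval[OF q]) (use rt sub in auto)
    then have "q' integrable_on {r..t}"
      by (rule integrable_spike[OF _ negligible_sing q'])
    have "integral {r..t} q = integral {r..t} q'"
      by (rule integral_spike[OF negligible_sing q'])
    also have "\<dots> \<le> integral {r..t} (\<lambda>_. 0)"
    proof (rule integral_le)
      fix s assume s: "s \<in> {r..t}"
      show "q' s \<le> 0"
      proof (cases "s = r")
        case False
        with s max have "s \<notin> Z"
          by force
        then show ?thesis
          using s rt t False by (simp add: q'_def Z_def decr)
      qed (simp add: q'_def)
    qed (use \<open>q' integrable_on {r..t}\<close> integrable_0 in simp_all)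
    finally show ?thesis by simp
  qed
  moreover have "integral {0..r} q + integral {r..t} q = integral {0..t} q"
    by (rule Henstock_Kurzweil_Integration.integral_combine[OF rt(1,2) integrable_on_subinterval[OF q sub]])
  moreover have "y r = y0 + integral {0..r} q"
    using rt t by (intro eq) simp
  ultimately show False
    using eq[OF t] rt(3) \<open>\<not> y t \<le> 0\<close> by linarith
qed

text \<open>The hypothesis \<open>inward\<close> is a subtangent condition with one step size
  \<open>\<kappa>\<close> for all times and points. It makes the extended field at any
  \<open>x\<close> equal to \<open>(z - x) /\<^sub>R \<kappa>\<close> for some
  \<open>z \<in> K\<close>, so outside a halfspace containing \<open>K\<close> the field pushes back
  towards it.\<close>

lemma convex_invariant_solution:
  fixes g :: "real \<Rightarrow> 'a::euclidean_space \<Rightarrow> 'a"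
  assumes T: "0 \<le> T" and K: "convex K" "compact K" and u0: "u0 \<in> K" and \<kappa>: "0 < \<kappa>"
    and meas: "\<And>u. \<lbrakk>continuous_on {0..T} u; u \<in> {0..T} \<rightarrow> K\<rbrakk>
      \<Longrightarrow> (\<lambda>s. g s (u s)) \<in> borel_measurable (lebesgue_on {0..T})"
    and lip: "\<And>s. s \<in> {0..T} \<Longrightarrow> L-lipschitz_on K (g s)"
    and inward: "\<And>s x. \<lbrakk>s \<in> {0..T}; x \<in> K\<rbrakk> \<Longrightarrow> x + \<kappa> *\<^sub>R g s x \<in> K"
  obtains u where "continuous_on {0..T} u" "u \<in> {0..T} \<rightarrow> K"
    "(\<lambda>s. g s (u s)) absolutely_integrable_on {0..T}"
    "\<And>t. t \<in> {0..T} \<Longrightarrow> u t = u0 + integral {0..t} (\<lambda>s. g s (u s))"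
proof -
  have K': "closed K" "K \<noteq> {}"
    using K u0 by (auto intro: compact_imp_closed)
  define P where "P = closest_point K"
  have P: "P x \<in> K" for x
    using K' by (simp add: P_def closest_point_in_set)
  have P_lip: "1-lipschitz_on UNIV P"
    using closest_point_lipschitz[OF K(1) K'] by (auto simp: P_def intro!: lipschitz_onI)
  \<comment> \<open>The factor \<open>1 / \<kappa>\<close> lets the terms combine to
    \<open>(P x + \<kappa> *\<^sub>R g s (P x) - x) /\<^sub>R \<kappa>\<close>, whose first two
    summands form a point of \<open>K\<close>. On \<open>K\<close> itself the correction
    vanishes.\<close>
  define G where "G s x = g s (P x) + (1 / \<kappa>) *\<^sub>R (P x - x)" for s x
  obtain M where M: "\<And>x. x \<in> K \<Longrightarrow> norm x \<le> M"
    using compact_imp_bounded[OF K(2)] by (auto simp: bounded_iff)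
  have "\<exists>u. continuous_on {0..T} u \<and> (\<lambda>s. G s (u s)) absolutely_integrable_on {0..T} \<and>
    (\<forall>t\<in>{0..T}. u t = u0 + integral {0..t} (\<lambda>s. G s (u s)))"
  proof (rule caratheodory_picard[OF T, of G])
    fix u :: "real \<Rightarrow> 'a" assume u: "continuous_on {0..T} u"
    have Pu: "continuous_on {0..T} (\<lambda>s. P (u s))"
      using continuous_on_compose2[OF lipschitz_on_continuous_on[OF P_lip] u] by simp
    then have "(\<lambda>s. (1 / \<kappa>) *\<^sub>R (P (u s) - u s)) \<in> borel_measurable (lebesgue_on {0..T})"
      by (intro continuous_imp_measurable_on_sets_lebesgue continuous_intros u) auto
    moreover have "(\<lambda>s. P (u s)) \<in> {0..T} \<rightarrow> K"
      using P by (rule funcsetI)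
    ultimately show "(\<lambda>s. G s (u s)) \<in> borel_measurable (lebesgue_on {0..T})"
      unfolding G_def by (intro borel_measurable_add meas Pu)
  next
    fix s assume s: "s \<in> {0..T}"
    have "(L * 1)-lipschitz_on UNIV (\<lambda>x. g s (P x))"
      by (rule lipschitz_on_compose2[OF P_lip lipschitz_on_subset[OF lip[OF s]]]) (use P in auto)
    then show "(L * 1 + \<bar>1 / \<kappa>\<bar> * (1 + 1))-lipschitz_on UNIV (G s)"
      unfolding G_def by (intro lipschitz_intros P_lip)
    \<comment> \<open>At the origin the combined form is a point of \<open>K\<close> divided by
      \<open>\<kappa>\<close>, so the bound on \<open>K\<close> holds uniformly in
      \<open>s\<close>.\<close>
    have "norm (G s 0) = norm (((P 0 + \<kappa> *\<^sub>R g s (P 0)) /\<^sub>R \<kappa>))"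
      using \<kappa> by (simp add: G_def algebra_simps inverse_eq_divide)
    also have "\<dots> \<le> M / \<kappa>"
      using M[OF inward[OF s P[of 0]]] \<kappa> by (simp add: divide_simps)
    finally show "norm (G s 0) \<le> M / \<kappa>" .
  qed blast
  then obtain u where u: "continuous_on {0..T} u"
    and Gu: "(\<lambda>s. G s (u s)) absolutely_integrable_on {0..T}"
    and eq: "\<And>t. t \<in> {0..T} \<Longrightarrow> u t = u0 + integral {0..t} (\<lambda>s. G s (u s))"
    by blast
  have Gint: "(\<lambda>s. G s (u s)) integrable_on {0..t}" if "t \<in> {0..T}" for t
    using absolutely_integrable_on_subinterval[OF Gu, of 0 t] that
      set_lebesgue_integral_eq_integral(1) by auto
  have uK: "u t \<in> K" if t: "t \<in> {0..T}" for t
  proof (rule ccontr)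
    assume "u t \<notin> K"
    \<comment> \<open>Strict separation reduces the claim to a scalar one: the excess
      \<open>b - c \<bullet> u s\<close> is negative at the start and, by \<open>inward\<close>,
      cannot grow while it is positive.\<close>
    then obtain c b where c: "c \<bullet> u t < b" and b: "\<And>x. x \<in> K \<Longrightarrow> b < c \<bullet> x"
      using separating_hyperplane_closed_point[OF K(1) K'(1)] by blast
    have "b - c \<bullet> u t \<le> 0"
    proof (rule nonpos_if_decreasing_where_positive[where y = "\<lambda>s. b - c \<bullet> u s" and ?y0.0 = "b - c \<bullet> u0" and T = T
          and q = "\<lambda>s. - (c \<bullet> G s (u s))"])
      show "continuous_on {0..T} (\<lambda>s. b - c \<bullet> u s)"
        by (intro continuous_intros u)
      show "(\<lambda>s. - (c \<bullet> G s (u s))) integrable_on {0..T}"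
        using integrable_neg[OF integrable_component[OF Gint[of T], of c]] T
        by (simp add: inner_commute)
      show "b - c \<bullet> u0 \<le> 0"
        using b[OF u0] by simp
      show "b - c \<bullet> u s = b - c \<bullet> u0 + integral {0..s} (\<lambda>s. - (c \<bullet> G s (u s)))"
        if "s \<in> {0..T}" for s
        using eq[OF that] integral_component_eq[OF Gint[OF that], of c]
        by (simp add: inner_add_right inner_commute)
      fix s assume s: "s \<in> {0..T}" and pos: "0 < b - c \<bullet> u s"
      have "G s (u s) = (1 / \<kappa>) *\<^sub>R (P (u s) + \<kappa> *\<^sub>R g s (P (u s)) - u s)"
        using \<kappa> by (simp add: G_def algebra_simps)
      then have "c \<bullet> G s (u s) = (1 / \<kappa>) * (c \<bullet> (P (u s) + \<kappa> *\<^sub>R g s (P (u s))) - c \<bullet> u s)"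
        by (simp only: inner_scaleR_right inner_diff_right)
      also have "\<dots> \<ge> 0"
        using b[OF inward[OF s P[of "u s"]]] pos \<kappa> by simp
      finally show "- (c \<bullet> G s (u s)) \<le> 0"
        by simp
    qed (rule t)
    with c show False by simp
  qed
  then have Gg: "G s (u s) = g s (u s)" if "s \<in> {0..T}" for s
    using that by (simp add: G_def P_def closest_point_self)
  show ?thesis
  proof
    show "continuous_on {0..T} u" "u \<in> {0..T} \<rightarrow> K"
      using u uK by auto
    show "(\<lambda>s. g s (u s)) absolutely_integrable_on {0..T}"
      using set_integrable_cong[THEN iffD1, OF refl refl _ Gu] Gg by auto
    fix t assume t: "t \<in> {0..T}"
    have "integral {0..t} (\<lambda>s. G s (u s)) = integral {0..t} (\<lambda>s. g s (u s))"
      by (rule Henstock_Kurzweil_Integration.integral_cong) (use t Gg in auto)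
    then show "u t = u0 + integral {0..t} (\<lambda>s. g s (u s))"
      using eq[OF t] by simp
  qed
qed

section \<open>The admissible states of one road\<close>

text \<open>This is the solid simplex spanned by the origin and the unit vectors, the range
  constraint that \<open>B_set\<close> imposes at each instant. It turns membership in
  \<open>B_set\<close> into invariance of a compact convex set.\<close>

definition admissible :: "(real^'n::finite) set" where
  "admissible = {x. (\<forall>j. 0 \<le> x $ j) \<and> density x \<le> 1}"

lemma density_add: "density (x + y) = density x + density y"
  by (simp add: density_def sum.distrib)

lemma density_scaleR: "density (c *\<^sub>R x) = c * density x"
  by (simp add: density_def sum_distrib_left)

lemma component_le_density:
  fixes x :: "real^'n::finite"
  assumes "\<And>j. 0 \<le> x $ j"
  shows "x $ j \<le> density x"
  unfolding density_def by (rule member_le_sum) (use assms in auto)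

lemma admissibleD:
  fixes x :: "real^'n::finite"
  assumes "x \<in> admissible"
  shows "0 \<le> x $ j" "x $ j \<le> 1" "density x \<in> {0..1}"
  using assms component_le_density[of x j]
  by (auto simp: admissible_def) (simp add: density_def sum_nonneg)

text \<open>Nonnegative entries with sum at most 1 are each at most 1, so the pointwise constraints
  amount to membership in \<open>admissible\<close>.\<close>

lemma B_set_iff: "u \<in> B_set T \<longleftrightarrow> continuous_on {0..T} u \<and> u \<in> {0..T} \<rightarrow> admissible"
  using admissibleD(2) by (auto simp: B_set_def X_space_def admissible_def density_def Pi_iff)

lemma convex_admissible: "convex (admissible :: (real^'n::finite) set)"
proof -
  show ?thesis
    by (rule convexI) (auto simp: admissible_def density_add density_scaleR intro: convex_bound_le)
qed

text \<open>Finitely many closed linear inequalities cut the set out, and on it the density equals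
  the l1 norm, which dominates the Euclidean norm.\<close>

lemma compact_admissible: "compact (admissible :: (real^'n::finite) set)"
proof -
  have "norm x \<le> 1" if "x \<in> admissible" for x :: "real^'n"
    using norm_le_l1_cart[of x] that by (auto simp: admissible_def density_def)
  then have "bounded (admissible :: (real^'n) set)"
    by (auto simp: bounded_iff)
  moreover have "closed (admissible :: (real^'n) set)"
    unfolding admissible_def density_def
    by (intro closed_Collect_conj closed_Collect_all closed_Collect_le continuous_intros)
  ultimately show ?thesis
    by (simp add: compact_eq_bounded_closed)
qed

section \<open>Calculus of bounded Lipschitz functions\<close>

text \<open>Boundedness is carried along because a product of Lipschitz functions need not be
  Lipschitz when the factors are unbounded. The class is closed under sums, differences and
  products.\<close>

definition bdd_lipschitz_on :: "'a::metric_space set \<Rightarrow> ('a \<Rightarrow> real) \<Rightarrow> bool" where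
  "bdd_lipschitz_on K f \<longleftrightarrow> bounded (f ` K) \<and> (\<exists>L. L-lipschitz_on K f)"

lemma bdd_lipschitz_onE:
  assumes "bdd_lipschitz_on K f"
  obtains M L where "0 \<le> M" "0 \<le> L" "\<And>x. x \<in> K \<Longrightarrow> \<bar>f x\<bar> \<le> M"
    "\<And>x y. \<lbrakk>x \<in> K; y \<in> K\<rbrakk> \<Longrightarrow> \<bar>f x - f y\<bar> \<le> L * dist x y"
proof -
  obtain M where M: "\<And>x. x \<in> K \<Longrightarrow> \<bar>f x\<bar> \<le> M"
    using assms by (auto simp: bdd_lipschitz_on_def bounded_iff)
  obtain L where L: "L-lipschitz_on K f"
    using assms by (auto simp: bdd_lipschitz_on_def)
  show ?thesis
  proof (rule that[of "\<bar>M\<bar>" L])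
    show "\<bar>f x\<bar> \<le> \<bar>M\<bar>" if "x \<in> K" for x
      using M[OF that] by simp
    show "\<bar>f x - f y\<bar> \<le> L * dist x y" if "x \<in> K" "y \<in> K" for x y
      using lipschitz_onD[OF L that] by (simp add: dist_real_def)
  qed (use lipschitz_on_nonneg[OF L] in auto)
qed

lemma bdd_lipschitz_onI:
  assumes "0 \<le> L" "\<And>x. x \<in> K \<Longrightarrow> \<bar>f x\<bar> \<le> M"
    "\<And>x y. \<lbrakk>x \<in> K; y \<in> K\<rbrakk> \<Longrightarrow> \<bar>f x - f y\<bar> \<le> L * dist x y"
  shows "bdd_lipschitz_on K f"
  using assms by (auto simp: bdd_lipschitz_on_def bounded_iff lipschitz_on_def dist_real_def)

lemma bdd_lipschitz_on_const: "bdd_lipschitz_on K (\<lambda>_. c)"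
  by (rule bdd_lipschitz_onI[of 0 _ _ "\<bar>c\<bar>"]) auto

lemma bdd_lipschitz_on_linear:
  assumes "bounded K" "bounded_linear f"
  shows "bdd_lipschitz_on K f"
  using assms bounded_linear_image bounded_linear.lipschitz_boundE
  unfolding bdd_lipschitz_on_def by metis

lemma bdd_lipschitz_on_add:
  assumes "bdd_lipschitz_on K f" "bdd_lipschitz_on K g"
  shows "bdd_lipschitz_on K (\<lambda>x. f x + g x)"
  using assms unfolding bdd_lipschitz_on_def by (blast intro: bounded_plus_comp lipschitz_on_add)

lemma bdd_lipschitz_on_diff:
  assumes "bdd_lipschitz_on K f" "bdd_lipschitz_on K g"
  shows "bdd_lipschitz_on K (\<lambda>x. f x - g x)"
  using assms unfolding bdd_lipschitz_on_def by (blast intro: bounded_minus_comp lipschitz_on_diff)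

text \<open>Splitting the difference at the mixed product \<open>f x * g y\<close> pairs the bound
  of one factor with the Lipschitz constant of the other.\<close>

lemma bdd_lipschitz_on_mult:
  assumes "bdd_lipschitz_on K f" "bdd_lipschitz_on K g"
  shows "bdd_lipschitz_on K (\<lambda>x. f x * g x)"
proof -
  obtain M L where f: "0 \<le> M" "0 \<le> L" "\<And>x. x \<in> K \<Longrightarrow> \<bar>f x\<bar> \<le> M"
    "\<And>x y. \<lbrakk>x \<in> K; y \<in> K\<rbrakk> \<Longrightarrow> \<bar>f x - f y\<bar> \<le> L * dist x y"
    using assms(1) by (rule bdd_lipschitz_onE) blast
  obtain M' L' where g: "0 \<le> M'" "0 \<le> L'" "\<And>x. x \<in> K \<Longrightarrow> \<bar>g x\<bar> \<le> M'"
    "\<And>x y. \<lbrakk>x \<in> K; y \<in> K\<rbrakk> \<Longrightarrow> \<bar>g x - g y\<bar> \<le> L' * dist x y"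
    using assms(2) by (rule bdd_lipschitz_onE) blast
  show ?thesis
  proof (rule bdd_lipschitz_onI)
    show "\<bar>f x * g x\<bar> \<le> M * M'" if "x \<in> K" for x
      unfolding abs_mult by (rule mult_mono[OF f(3)[OF that] g(3)[OF that] f(1) abs_ge_zero])
    fix x y assume xy: "x \<in> K" "y \<in> K"
    have "\<bar>f x * g x - f y * g y\<bar> = \<bar>f x * (g x - g y) + (f x - f y) * g y\<bar>"
      by (simp add: algebra_simps)
    also have "\<dots> \<le> \<bar>f x\<bar> * \<bar>g x - g y\<bar> + \<bar>f x - f y\<bar> * \<bar>g y\<bar>"
      unfolding abs_mult[symmetric] by (rule abs_triangle_ineq)
    also have "\<dots> \<le> M * (L' * dist x y) + L * dist x y * M'"
      by (intro add_mono mult_mono f g xy mult_nonneg_nonneg) auto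
    finally show "\<bar>f x * g x - f y * g y\<bar> \<le> (M * L' + L * M') * dist x y"
      by (simp add: algebra_simps)
  qed (use f(1,2) g(1,2) in auto)
qed

lemma bdd_lipschitz_on_sum:
  assumes "\<And>i. i \<in> I \<Longrightarrow> bdd_lipschitz_on K (f i)"
  shows "bdd_lipschitz_on K (\<lambda>x. \<Sum>i\<in>I. f i x)"
  using assms
  by (induction I rule: infinite_finite_induct)
    (simp_all add: bdd_lipschitz_on_const bdd_lipschitz_on_add)

text \<open>Compactness of \<open>I\<close> makes the Lipschitz function \<open>h\<close> bounded
  there. This brings in the table of games, which is controlled only for densities in
  \<open>{0..1}\<close>.\<close>

lemma bdd_lipschitz_on_compose:
  assumes f: "bdd_lipschitz_on K f" and I: "f \<in> K \<rightarrow> I" "compact I" and h: "L-lipschitz_on I h"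
  shows "bdd_lipschitz_on K (\<lambda>x. h (f x))"
proof -
  have sub: "f ` K \<subseteq> I"
    using I by auto
  have "bounded (h ` I)"
    by (intro compact_imp_bounded compact_continuous_image I lipschitz_on_continuous_on[OF h])
  then have "bounded ((\<lambda>x. h (f x)) ` K)"
    by (rule bounded_subset) (use sub in auto)
  moreover obtain M where "M-lipschitz_on K f"
    using f by (auto simp: bdd_lipschitz_on_def)
  then have "(L * M)-lipschitz_on K (\<lambda>x. h (f x))"
    by (rule lipschitz_on_compose2) (rule lipschitz_on_subset[OF h sub])
  ultimately show ?thesis
    by (auto simp: bdd_lipschitz_on_def)
qed

lemma flux_limiter_mem:
  assumes "flux_limiter \<Phi>" "u \<in> {0..1}" "w \<in> {0..1}"
  shows "\<Phi> u w \<in> {0..1}"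
  using assms(1)[unfolded flux_limiter_def, THEN conjunct1] assms(2,3) by auto

lemma bdd_lipschitz_on_flux_limiter:
  assumes \<Phi>: "flux_limiter \<Phi>" and p: "bdd_lipschitz_on K p" "p \<in> K \<rightarrow> {0..1}"
    and q: "bdd_lipschitz_on K q" "q \<in> K \<rightarrow> {0..1}"
  shows "bdd_lipschitz_on K (\<lambda>x. \<Phi> (p x) (q x))"
proof -
  obtain C where C: "C > 0" and lip: "\<And>u1 v1 u2 v2. \<lbrakk>u1 \<in> {0..1}; v1 \<in> {0..1}; u2 \<in> {0..1}; v2 \<in> {0..1}\<rbrakk>
      \<Longrightarrow> \<bar>\<Phi> u2 v2 - \<Phi> u1 v1\<bar> \<le> C * (\<bar>u2 - u1\<bar> + \<bar>v2 - v1\<bar>)"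
    using \<Phi> unfolding flux_limiter_def by blast
  obtain L where L: "0 \<le> L" "\<And>x y. \<lbrakk>x \<in> K; y \<in> K\<rbrakk> \<Longrightarrow> \<bar>p x - p y\<bar> \<le> L * dist x y"
    using p(1) by (rule bdd_lipschitz_onE) blast
  obtain L' where L': "0 \<le> L'" "\<And>x y. \<lbrakk>x \<in> K; y \<in> K\<rbrakk> \<Longrightarrow> \<bar>q x - q y\<bar> \<le> L' * dist x y"
    using q(1) by (rule bdd_lipschitz_onE) blast
  have mem: "p x \<in> {0..1}" "q x \<in> {0..1}" if "x \<in> K" for x
    using funcset_mem[OF p(2) that] funcset_mem[OF q(2) that] .
  show ?thesis
  proof (rule bdd_lipschitz_onI)
    show "\<bar>\<Phi> (p x) (q x)\<bar> \<le> 1" if "x \<in> K" for x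
      using flux_limiter_mem[OF \<Phi> mem[OF that]] by simp
    fix x y assume xy: "x \<in> K" "y \<in> K"
    have "\<bar>\<Phi> (p x) (q x) - \<Phi> (p y) (q y)\<bar> \<le> C * (\<bar>p x - p y\<bar> + \<bar>q x - q y\<bar>)"
      by (intro lip mem xy)
    also have "\<dots> \<le> C * (L * dist x y + L' * dist x y)"
      using C by (intro mult_left_mono add_mono L L' xy) auto
    finally show "\<bar>\<Phi> (p x) (q x) - \<Phi> (p y) (q y)\<bar> \<le> C * (L + L') * dist x y"
      by (simp add: algebra_simps)
  qed (use C L L' in auto)
qed

text \<open>The Euclidean norm is at most the l1 norm, so the constants of the components add up to
  one for the vector.\<close>

lemma lipschitz_on_vec_lambda:
  fixes f :: "'n::finite \<Rightarrow> 'a::metric_space \<Rightarrow> real"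
  assumes "\<And>j. bdd_lipschitz_on K (f j)"
  shows "\<exists>L. L-lipschitz_on K (\<lambda>x. \<chi> j. f j x)"
proof -
  have "\<exists>L\<ge>0. \<forall>x\<in>K. \<forall>y\<in>K. \<bar>f j x - f j y\<bar> \<le> L * dist x y" for j
    using assms[of j] by (rule bdd_lipschitz_onE) blast
  then obtain L where L: "\<And>j. 0 \<le> L j"
    "\<And>j x y. \<lbrakk>x \<in> K; y \<in> K\<rbrakk> \<Longrightarrow> \<bar>f j x - f j y\<bar> \<le> L j * dist x y"
    by metis
  have "(\<Sum>j\<in>UNIV. L j)-lipschitz_on K (\<lambda>x. \<chi> j. f j x)"
  proof (rule lipschitz_onI)
    fix x y assume xy: "x \<in> K" "y \<in> K"
    have "dist (\<chi> j. f j x) (\<chi> j. f j y) \<le> (\<Sum>j\<in>UNIV. \<bar>f j x - f j y\<bar>)"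
      using norm_le_l1_cart[of "(\<chi> j. f j x) - (\<chi> j. f j y)"] by (simp add: dist_norm)
    also have "\<dots> \<le> (\<Sum>j\<in>UNIV. L j * dist x y)"
      by (intro sum_mono L xy)
    finally show "dist (\<chi> j. f j x) (\<chi> j. f j y) \<le> (\<Sum>j\<in>UNIV. L j) * dist x y"
      by (simp add: sum_distrib_right)
  qed (use L in \<open>auto intro: sum_nonneg\<close>)
  then show ?thesis ..
qed

section \<open>Lipschitz dependence of the right-hand sides on all their arguments\<close>

text \<open>The range condition keeps densities in \<open>{0..1}\<close>, where the assumptions on
  \<open>A\<close> and \<open>\<Phi>\<close> apply. The map \<open>f\<close> stands for one vector
  argument of a right-hand side, later a coordinate projection of a product of boundary data and
  states.\<close>

definition admissible_lipschitz_on :: "'a::metric_space set \<Rightarrow> ('a \<Rightarrow> real^'n::finite) \<Rightarrow> bool" where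
  "admissible_lipschitz_on K f \<longleftrightarrow>
     f \<in> K \<rightarrow> admissible \<and> (\<forall>j. bdd_lipschitz_on K (\<lambda>x. f x $ j))"

lemmas bdd_lipschitz_intros = bdd_lipschitz_on_const bdd_lipschitz_on_add bdd_lipschitz_on_diff
  bdd_lipschitz_on_mult bdd_lipschitz_on_sum

lemma bdd_lipschitz_on_component:
  "admissible_lipschitz_on K f \<Longrightarrow> bdd_lipschitz_on K (\<lambda>x. f x $ j)"
  by (simp add: admissible_lipschitz_on_def)

lemma bdd_lipschitz_on_density:
  "admissible_lipschitz_on K f \<Longrightarrow> bdd_lipschitz_on K (\<lambda>x. density (f x))"
  unfolding density_def by (intro bdd_lipschitz_intros bdd_lipschitz_on_component)

lemma bdd_lipschitz_on_gain:
  fixes f :: "'a::metric_space \<Rightarrow> real^'n::finite"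
  assumes f: "admissible_lipschitz_on K f" and A: "table_of_games A"
  shows "bdd_lipschitz_on K (\<lambda>x. gain \<eta>0 A j (f x))"
proof -
  have "bdd_lipschitz_on K (\<lambda>x. A h k j (density (f x)))" for h k
  proof -
    obtain L where "L-lipschitz_on {0..1} (A h k j)"
      using A unfolding table_of_games_def by blast
    then show ?thesis
      using f admissibleD(3)
      by (intro bdd_lipschitz_on_compose[where h = "A h k j", OF bdd_lipschitz_on_density[OF f]])
        (auto simp: admissible_lipschitz_on_def Pi_iff)
  qed
  then show ?thesis
    unfolding gain_def
    by (intro bdd_lipschitz_intros bdd_lipschitz_on_component bdd_lipschitz_on_density f)
qed

lemma bdd_lipschitz_on_loss:
  "admissible_lipschitz_on K f \<Longrightarrow> bdd_lipschitz_on K (\<lambda>x. loss \<eta>0 (f x))"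
  unfolding loss_def power2_eq_square by (intro bdd_lipschitz_intros bdd_lipschitz_on_density)

text \<open>Omitting the resting class from a sum of nonnegative entries cannot raise it, so the
  first argument of the junction limiter stays where \<open>\<Phi>\<close> is controlled.\<close>

lemma moving_density_mem:
  fixes x :: "real^'n::{finite,linorder}"
  assumes "x \<in> admissible" "c \<in> {0..1}"
  shows "c * (\<Sum>j\<in>UNIV - {first_class}. x $ j) \<in> {0..1}"
proof -
  have "(\<Sum>j\<in>UNIV - {first_class}. x $ j) \<le> density x"
    unfolding density_def by (rule sum_mono2) (use admissibleD[OF assms(1)] in auto)
  moreover have "0 \<le> (\<Sum>j\<in>UNIV - {first_class}. x $ j)"
    by (rule sum_nonneg) (use admissibleD[OF assms(1)] in auto)
  ultimately show ?thesis
    using admissibleD(3)[OF assms(1)] assms(2) by (simp add: mult_le_one)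
qed

lemma bdd_lipschitz_on_junction_limiter:
  fixes f g :: "'a::metric_space \<Rightarrow> real^'n::{finite,linorder}"
  assumes \<Phi>: "flux_limiter \<Phi>" and c: "c \<in> {0..1}"
    and f: "admissible_lipschitz_on K f" and g: "admissible_lipschitz_on K g"
  shows "bdd_lipschitz_on K (\<lambda>x. junction_limiter \<Phi> c (f x) (g x))"
  unfolding junction_limiter_def
proof (intro bdd_lipschitz_on_flux_limiter[OF \<Phi>] bdd_lipschitz_intros
    bdd_lipschitz_on_component bdd_lipschitz_on_density f g)
  show "(\<lambda>x. c * (\<Sum>j\<in>UNIV - {first_class}. f x $ j)) \<in> K \<rightarrow> {0..1}"
    using f c moving_density_mem by (auto simp: admissible_lipschitz_on_def Pi_iff simp del: atLeastAtMost_iff)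
  show "(\<lambda>x. density (g x)) \<in> K \<rightarrow> {0..1}"
    using g admissibleD(3) by (auto simp: admissible_lipschitz_on_def Pi_iff)
qed

lemma bdd_lipschitz_on_rhs_in:
  assumes \<Phi>: "flux_limiter \<Phi>" and A: "table_of_games A" and a: "a \<in> {0..1}"
    and f: "admissible_lipschitz_on K f1b" "admissible_lipschitz_on K f1"
      "admissible_lipschitz_on K f2" "admissible_lipschitz_on K f3"
  shows "bdd_lipschitz_on K (\<lambda>x. rhs_in v a \<eta>0 A \<Phi> (f1b x) (f1 x) (f2 x) (f3 x) j)"
proof -
  have "(\<lambda>x. density (f1b x)) \<in> K \<rightarrow> {0..1}" "(\<lambda>x. density (f1 x)) \<in> K \<rightarrow> {0..1}"
    using f(1,2) admissibleD(3) by (auto simp: admissible_lipschitz_on_def Pi_iff)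
  then have "bdd_lipschitz_on K (\<lambda>x. \<Phi> (density (f1b x)) (density (f1 x)))"
    by (intro bdd_lipschitz_on_flux_limiter[OF \<Phi>] bdd_lipschitz_on_density f)
  moreover have "1 - a \<in> {0..1}"
    using a by simp
  ultimately show ?thesis
    unfolding rhs_in_def
    by (intro bdd_lipschitz_intros bdd_lipschitz_on_component bdd_lipschitz_on_junction_limiter
        bdd_lipschitz_on_gain bdd_lipschitz_on_loss \<Phi> A a f)
qed

lemma bdd_lipschitz_on_rhs_out:
  assumes "flux_limiter \<Phi>" "table_of_games A" "c \<in> {0..1}"
    and "bdd_lipschitz_on K b" "admissible_lipschitz_on K f1" "admissible_lipschitz_on K g"
  shows "bdd_lipschitz_on K (\<lambda>x. rhs_out v c \<eta>0 A \<Phi> (b x) (f1 x) (g x) j)"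
  unfolding rhs_out_def
  by (intro bdd_lipschitz_intros bdd_lipschitz_on_component
      bdd_lipschitz_on_junction_limiter bdd_lipschitz_on_gain bdd_lipschitz_on_loss assms)

section \<open>The right-hand sides point into the admissible set\<close>

text \<open>The flux limiter postulates this bound for \<open>u + w > 1\<close>. Otherwise
  \<open>\<Phi> u w \<le> 1\<close> already gives
  \<open>\<Phi> u w * u \<le> u \<le> 1 - w\<close>.\<close>

lemma flux_le:
  assumes "flux_limiter \<Phi>" "u \<in> {0..1}" "w \<in> {0..1}"
  shows "\<Phi> u w * u \<le> 1 - w"
proof (cases "u + w > 1")
  case True
  have "\<forall>u\<in>{0..1}. \<forall>w\<in>{0..1}. u + w > 1 \<longrightarrow> \<Phi> u w * u \<le> 1 - w"
    using assms(1) unfolding flux_limiter_def by (elim conjE)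
  from this[rule_format, OF assms(2,3) True] show ?thesis .
next
  case False
  have "\<Phi> u w * u \<le> u"
    using flux_limiter_mem[OF assms] assms(2) by (intro mult_left_le_one_le) simp_all
  with False show ?thesis by simp
qed

lemma gain_nonneg:
  assumes "table_of_games A" "x \<in> admissible" "0 \<le> \<eta>0"
  shows "0 \<le> gain \<eta>0 A j x"
proof -
  have "0 \<le> A h k j (density x)" for h k
    using assms(1) admissibleD(3)[OF assms(2)] unfolding table_of_games_def by blast
  then show ?thesis
    using admissibleD(3)[OF assms(2)] unfolding gain_def
    by (intro mult_nonneg_nonneg sum_nonneg assms(3) admissibleD(1)[OF assms(2)]) auto
qed

text \<open>Interactions only move vehicles between speed classes: with the sum over
  \<open>j\<close> innermost the transition probabilities add up to 1, and what remains is
  \<open>\<eta>0\<close> times the cube of the density.\<close>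

lemma sum_gain:
  fixes x :: "real^'n::finite"
  assumes "table_of_games A" "x \<in> admissible"
  shows "(\<Sum>j\<in>UNIV. gain \<eta>0 A j x) = density x * loss \<eta>0 x"
proof -
  let ?\<rho> = "density x"
  have A: "(\<Sum>j\<in>UNIV. A h k j ?\<rho>) = 1" for h k
    using assms admissibleD(3)[OF assms(2)] unfolding table_of_games_def by blast
  have "(\<Sum>j\<in>UNIV. \<Sum>h\<in>UNIV. \<Sum>k\<in>UNIV. A h k j ?\<rho> * x $ h * x $ k)
      = (\<Sum>h\<in>UNIV. \<Sum>k\<in>UNIV. \<Sum>j\<in>UNIV. A h k j ?\<rho> * x $ h * x $ k)"
    by (subst sum.swap) (rule sum.cong[OF refl], rule sum.swap)
  also have "\<dots> = (\<Sum>h\<in>UNIV. \<Sum>k\<in>UNIV. x $ h * x $ k)"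
    by (simp add: A flip: sum_distrib_right)
  also have "\<dots> = ?\<rho>\<^sup>2"
    by (simp add: density_def power2_eq_square sum_product)
  finally show ?thesis
    by (simp add: gain_def loss_def flip: sum_distrib_left)
qed

text \<open>The first bound on \<open>r\<close> keeps every entry nonnegative after a step of length
  \<open>1 / (1 + \<eta>0)\<close>. The second lets the step use at most the free capacity
  \<open>1 - density x\<close>, as its length is below 1.\<close>

lemma admissible_step:
  fixes x r :: "real^'n::finite"
  assumes x: "x \<in> admissible" and \<eta>0: "0 < \<eta>0"
    and r: "\<And>j. - (1 + \<eta>0) * x $ j \<le> r $ j" and sum: "density r \<le> 1 - density x"
  shows "x + (1 / (1 + \<eta>0)) *\<^sub>R r \<in> admissible"
proof -
  have "0 \<le> x $ j + r $ j / (1 + \<eta>0)" for j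
    using r[of j] \<eta>0 by (simp add: field_simps)
  moreover have "density r / (1 + \<eta>0) \<le> 1 - density x"
  proof -
    have "0 \<le> (1 - density x) * \<eta>0"
      using admissibleD(3)[OF x] \<eta>0 by (intro mult_nonneg_nonneg) auto
    then have "density r \<le> (1 - density x) * (1 + \<eta>0)"
      using sum by (simp add: distrib_left)
    then show ?thesis
      using \<eta>0 by (simp add: divide_le_eq)
  qed
  ultimately show ?thesis
    by (simp add: admissible_def density_add density_scaleR)
qed

lemma loss_bounds:
  assumes "x \<in> admissible" "0 \<le> \<eta>0"
  shows "0 \<le> loss \<eta>0 x" "loss \<eta>0 x \<le> \<eta>0"
  using admissibleD(3)[OF assms(1)] assms(2)
  by (auto simp: loss_def abs_square_le_1 intro!: mult_left_le)

lemma junction_limiter_mem: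
  assumes "flux_limiter \<Phi>" "c \<in> {0..1}" "x \<in> admissible" "y \<in> admissible"
  shows "junction_limiter \<Phi> c x y \<in> {0..1}"
  unfolding junction_limiter_def
  by (rule flux_limiter_mem[OF assms(1) moving_density_mem[OF assms(3,2)] admissibleD(3)[OF assms(4)]])

text \<open>The outflow coefficient is \<open>v j \<le> 1\<close> times a convex combination of
  limiters, and the loss rate is at most \<open>\<eta>0\<close>; this gives the lower bound. In the
  density, gain and loss cancel, outflow only helps, and the inflow is at most
  \<open>\<Phi> (density f1b) (density f1) * density f1b\<close>, to which \<open>flux_le\<close>
  applies.\<close>

lemma rhs_in_inward:
  fixes f1b f1 f2 f3 :: "real^'n::{finite,linorder}"
  assumes \<Phi>: "flux_limiter \<Phi>" and A: "table_of_games A" and a: "a \<in> {0..1}" and \<eta>0: "0 < \<eta>0"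
    and v: "\<And>j. v j \<in> {0..1}"
    and f: "f1b \<in> admissible" "f1 \<in> admissible" "f2 \<in> admissible" "f3 \<in> admissible"
  shows "f1 + (1 / (1 + \<eta>0)) *\<^sub>R (\<chi> j. rhs_in v a \<eta>0 A \<Phi> f1b f1 f2 f3 j) \<in> admissible"
proof (rule admissible_step[OF f(2) \<eta>0])
  define \<Psi> where "\<Psi> = a * junction_limiter \<Phi> a f1 f2 + (1 - a) * junction_limiter \<Phi> (1 - a) f1 f3"
  have \<Psi>: "0 \<le> \<Psi>" "\<Psi> \<le> 1"
  proof -
    have "1 - a \<in> {0..1}"
      using a by auto
    note J = junction_limiter_mem[OF \<Phi> a f(2,3)] junction_limiter_mem[OF \<Phi> this f(2,4)]
    show "0 \<le> \<Psi>"
      unfolding \<Psi>_def using J a by auto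
    show "\<Psi> \<le> 1"
      unfolding \<Psi>_def by (rule convex_bound_le) (use J a in simp_all)
  qed
  define P where "P = \<Phi> (density f1b) (density f1)"
  have P: "0 \<le> P"
    using flux_limiter_mem[OF \<Phi> admissibleD(3)[OF f(1)] admissibleD(3)[OF f(2)]]
    by (simp add: P_def)
  have nn: "0 \<le> f1 $ j" "0 \<le> f1b $ j" "0 \<le> v j" "v j \<le> 1" for j
    using admissibleD(1)[OF f(1), of j] admissibleD(1)[OF f(2), of j] v[of j] by simp_all
  have rhs: "rhs_in v a \<eta>0 A \<Phi> f1b f1 f2 f3 j
      = v j * P * f1b $ j - v j * \<Psi> * f1 $ j + gain \<eta>0 A j f1 - f1 $ j * loss \<eta>0 f1" for j
    by (simp add: rhs_in_def P_def \<Psi>_def algebra_simps)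
  show "- (1 + \<eta>0) * f1 $ j \<le> (\<chi> j. rhs_in v a \<eta>0 A \<Phi> f1b f1 f2 f3 j) $ j" for j
  proof -
    have "v j * \<Psi> * f1 $ j \<le> 1 * f1 $ j"
      by (rule mult_right_mono[OF mult_le_one[OF nn(4) \<Psi>] nn(1)])
    moreover have "f1 $ j * loss \<eta>0 f1 \<le> f1 $ j * \<eta>0"
      by (rule mult_left_mono[OF loss_bounds(2)[OF f(2) less_imp_le[OF \<eta>0]] nn(1)])
    moreover have "0 \<le> v j * P * f1b $ j"
      by (intro mult_nonneg_nonneg nn P)
    moreover have "0 \<le> gain \<eta>0 A j f1"
      using gain_nonneg[OF A f(2)] \<eta>0 by simp
    ultimately show ?thesis
      by (simp add: rhs algebra_simps)
  qed
  have "density (\<chi> j. rhs_in v a \<eta>0 A \<Phi> f1b f1 f2 f3 j)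
      = (\<Sum>j\<in>UNIV. v j * P * f1b $ j - v j * \<Psi> * f1 $ j) + (\<Sum>j\<in>UNIV. gain \<eta>0 A j f1)
        - (\<Sum>j\<in>UNIV. f1 $ j * loss \<eta>0 f1)"
    by (simp add: density_def rhs sum.distrib sum_subtractf)
  also have "\<dots> = (\<Sum>j\<in>UNIV. v j * P * f1b $ j - v j * \<Psi> * f1 $ j)"
    by (simp add: sum_gain[OF A f(2)] density_def sum_distrib_right)
  also have "\<dots> \<le> (\<Sum>j\<in>UNIV. P * f1b $ j)"
  proof (rule sum_mono)
    fix j
    have "v j * (P * f1b $ j) \<le> P * f1b $ j"
      by (intro mult_left_le_one_le mult_nonneg_nonneg nn P)
    moreover have "0 \<le> v j * \<Psi> * f1 $ j"
      by (intro mult_nonneg_nonneg nn \<Psi>)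
    ultimately show "v j * P * f1b $ j - v j * \<Psi> * f1 $ j \<le> P * f1b $ j"
      by (simp add: mult.assoc)
  qed
  also have "\<dots> = P * density f1b"
    by (simp add: density_def sum_distrib_left)
  also have "\<dots> \<le> 1 - density f1"
    unfolding P_def by (rule flux_le[OF \<Phi>]) (use admissibleD(3) f in auto)
  finally show "density (\<chi> j. rhs_in v a \<eta>0 A \<Phi> f1b f1 f2 f3 j) \<le> 1 - density f1" .
qed

text \<open>The same balance holds as on the incoming road, with inflow through the junction: its
  total over all classes is at most the limiter times the limiter's own first argument, the form
  that \<open>flux_le\<close> requires.\<close>

lemma rhs_out_inward:
  fixes f1 g :: "real^'n::{finite,linorder}"
  assumes \<Phi>: "flux_limiter \<Phi>" and A: "table_of_games A" and c: "c \<in> {0..1}" and \<eta>0: "0 < \<eta>0"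
    and v: "\<And>j. v j \<in> {0..1}" and b: "b \<in> {0..1}"
    and f: "f1 \<in> admissible" "g \<in> admissible"
  shows "g + (1 / (1 + \<eta>0)) *\<^sub>R (\<chi> j. rhs_out v c \<eta>0 A \<Phi> b f1 g j) \<in> admissible"
proof (rule admissible_step[OF f(2) \<eta>0])
  define P where "P = junction_limiter \<Phi> c f1 g"
  have P: "0 \<le> P"
    using junction_limiter_mem[OF \<Phi> c f] unfolding P_def by simp
  have nn: "0 \<le> f1 $ j" "0 \<le> g $ j" "0 \<le> v j" "v j \<le> 1" "0 \<le> \<delta>c j" for j
    using admissibleD(1)[OF f(1), of j] admissibleD(1)[OF f(2), of j] v[of j] by (simp_all add: \<delta>c_def)
  have b01: "0 \<le> b" "b \<le> 1"
    using b by simp_all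
  define q where "q j = P * (c * (f1 $ j * \<delta>c j))" for j
  have rhs: "rhs_out v c \<eta>0 A \<Phi> b f1 g j
      = v j * q j - v j * b * g $ j + gain \<eta>0 A j g - g $ j * loss \<eta>0 g" for j
    by (simp add: rhs_out_def P_def q_def algebra_simps)
  have q: "0 \<le> q j" for j
    unfolding q_def by (intro mult_nonneg_nonneg P nn) (use c in simp)
  show "- (1 + \<eta>0) * g $ j \<le> (\<chi> j. rhs_out v c \<eta>0 A \<Phi> b f1 g j) $ j" for j
  proof -
    have "v j * b * g $ j \<le> 1 * g $ j"
      by (rule mult_right_mono[OF mult_le_one[OF nn(4) b01] nn(2)])
    moreover have "g $ j * loss \<eta>0 g \<le> g $ j * \<eta>0"
      by (rule mult_left_mono[OF loss_bounds(2)[OF f(2) less_imp_le[OF \<eta>0]] nn(2)])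
    moreover have "0 \<le> v j * q j"
      by (rule mult_nonneg_nonneg[OF nn(3) q])
    moreover have "0 \<le> gain \<eta>0 A j g"
      using gain_nonneg[OF A f(2)] \<eta>0 by simp
    ultimately show ?thesis
      by (simp add: rhs algebra_simps)
  qed
  have "density (\<chi> j. rhs_out v c \<eta>0 A \<Phi> b f1 g j)
      = (\<Sum>j\<in>UNIV. v j * q j - v j * b * g $ j)
        + (\<Sum>j\<in>UNIV. gain \<eta>0 A j g) - (\<Sum>j\<in>UNIV. g $ j * loss \<eta>0 g)"
    by (simp add: density_def rhs sum.distrib sum_subtractf)
  also have "\<dots> = (\<Sum>j\<in>UNIV. v j * q j - v j * b * g $ j)"
    by (simp add: sum_gain[OF A f(2)] density_def sum_distrib_right)
  also have "\<dots> \<le> (\<Sum>j\<in>UNIV. q j)"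
  proof (rule sum_mono)
    fix j
    have "v j * q j \<le> q j"
      by (rule mult_left_le_one_le[OF q nn(3,4)])
    moreover have "0 \<le> v j * b * g $ j"
      by (intro mult_nonneg_nonneg nn b01)
    ultimately show "v j * q j - v j * b * g $ j
        \<le> q j"
      by simp
  qed
  also have "\<dots> = P * (c * (\<Sum>j\<in>UNIV. f1 $ j * \<delta>c j))"
    by (simp add: q_def sum_distrib_left)
  \<comment> \<open>The factor \<open>\<delta>c\<close> matches the omission of the resting class in
    \<open>junction_limiter\<close>, so the inflow bound uses precisely the density at which
    \<open>\<Phi>\<close> is evaluated.\<close>
  also have "(\<Sum>j\<in>UNIV. f1 $ j * \<delta>c j) = (\<Sum>j\<in>UNIV - {first_class}. f1 $ j)"
    by (rule sum.mono_neutral_cong_right) (auto simp: \<delta>c_def)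
  also have "P * (c * (\<Sum>j\<in>UNIV - {first_class}. f1 $ j)) \<le> 1 - density g"
    unfolding P_def junction_limiter_def
    by (rule flux_le[OF \<Phi> moving_density_mem[OF f(1) c] admissibleD(3)[OF f(2)]])
  finally show "density (\<chi> j. rhs_out v c \<eta>0 A \<Phi> b f1 g j) \<le> 1 - density g" .
qed

section \<open>From a solution in the product space to a mild kinetic solution\<close>

text \<open>For an absolutely integrable function the gauge integral agrees with the Lebesgue
  integral, and both properties pass to components.\<close>

lemma integral_equationI:
  fixes q :: "real \<Rightarrow> real^'n::finite"
  assumes q: "q absolutely_integrable_on {0..T}"
    and u: "\<And>t. t \<in> {0..T} \<Longrightarrow> u t = u0 + integral {0..t} q"
  shows "integral_equation T (u0 $ j) (\<lambda>s. q s $ j) (\<lambda>t. u t $ j)"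
  unfolding integral_equation_def
proof (intro ballI conjI)
  fix t assume t: "t \<in> {0..T}"
  then have qt: "q absolutely_integrable_on {0..t}"
    by (intro absolutely_integrable_on_subinterval[OF q]) auto
  have "(\<lambda>s. q s \<bullet> axis j 1) absolutely_integrable_on {0..t}"
    by (rule absolutely_integrable_component[OF qt])
  then show qj: "(\<lambda>s. q s $ j) absolutely_integrable_on {0..t}"
    by (simp add: inner_axis)
  show "u t $ j = u0 $ j + (LINT s:{0..t}|lebesgue. q s $ j)"
    using integral_component_eq_cart[OF set_lebesgue_integral_eq_integral(1)[OF qt]]
    by (simp add: u[OF t] set_lebesgue_integral_eq_integral(2)[OF qj])
qed

theorem theorem4p3:
  fixes T a \<eta>0 :: real
    and v :: "'n::{finite,linorder} \<Rightarrow> real"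
    and A :: "'n \<Rightarrow> 'n \<Rightarrow> 'n \<Rightarrow> real \<Rightarrow> real"
    and \<Phi> :: "real \<Rightarrow> real \<Rightarrow> real"
    and \<phi>1 \<phi>2 \<phi>3 :: "real^'n::{finite,linorder}"
    and f1b :: "real \<Rightarrow> real^'n::{finite,linorder}"
    and \<Phi>b2 \<Phi>b3 :: "real \<Rightarrow> real"
  assumes "T > 0"
    and "CARD('n) \<ge> 2"
    and "strict_mono v" and "v first_class = 0" and "v last_class = 1"
    and "a \<in> {0..1}"
    and "\<eta>0 > 0"
    and "table_of_games A"
    and "flux_limiter \<Phi>"
    and "(\<lambda>_. \<phi>1) \<in> B_set T" and "(\<lambda>_. \<phi>2) \<in> B_set T" and "(\<lambda>_. \<phi>3) \<in> B_set T"
    and "f1b \<in> B_set T"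
    and "\<forall>t\<in>{0..T}. \<Phi>b2 t \<in> {0..1}" and "\<Phi>b2 \<in> borel_measurable (lebesgue_on {0..T})"
    and "\<forall>t\<in>{0..T}. \<Phi>b3 t \<in> {0..1}" and "\<Phi>b3 \<in> borel_measurable (lebesgue_on {0..T})"
  shows "\<exists>F \<in> B_set T \<times> B_set T \<times> B_set T.
           mild_kinetic_solution T v a \<eta>0 A \<Phi> \<phi>1 \<phi>2 \<phi>3 f1b \<Phi>b2 \<Phi>b3 F"
proof -
  let ?S = "admissible :: (real^'n::{finite,linorder}) set"
  define K where "K = ?S \<times> ?S \<times> ?S"
  \<comment> \<open>The time-dependent data are treated as further arguments with values in the
    compact set \<open>Y\<close>. One joint Lipschitz estimate for \<open>H\<close> on
    \<open>Y \<times> K\<close> then yields both the Lipschitz bound in the state, uniform in time,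
    and measurability in time.\<close>
  define Y where "Y = ?S \<times> {0..1::real} \<times> {0..1::real}"
  define y where "y s = (f1b s, \<Phi>b2 s, \<Phi>b3 s)" for s
  define H where "H = (\<lambda>((b1, b2, b3), (f1, f2, f3)).
    (\<chi> j. rhs_in v a \<eta>0 A \<Phi> b1 f1 f2 f3 j,
     \<chi> j. rhs_out v a \<eta>0 A \<Phi> b2 f1 f2 j,
     \<chi> j. rhs_out v (1 - a) \<eta>0 A \<Phi> b3 f1 f3 j))"
  note \<Phi> = \<open>flux_limiter \<Phi>\<close> and A = \<open>table_of_games A\<close> and a = \<open>a \<in> {0..1}\<close>
    and \<eta>0 = \<open>\<eta>0 > 0\<close> and T = \<open>T > 0\<close>
  have a': "1 - a \<in> {0..1}"
    using a by auto
  have v: "v j \<in> {0..1}" for j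
    using assms(3-5)
    by (metis Max_ge Min_le UNIV_I atLeastAtMost_iff finite_class.finite_UNIV strict_mono_less_eq)
  have K: "convex K" "compact K"
    unfolding K_def by (intro convex_Times compact_Times convex_admissible compact_admissible)+
  have YK: "compact (Y \<times> K)"
    unfolding Y_def by (intro compact_Times compact_admissible K(2)) auto
  have init: "x \<in> ?S" if "(\<lambda>_. x) \<in> B_set T" for x
    using that T funcset_mem[of "\<lambda>_. x" "{0..T}" ?S 0] by (simp add: B_set_iff)
  have f1b: "continuous_on {0..T} f1b" "f1b \<in> {0..T} \<rightarrow> ?S"
    using \<open>f1b \<in> B_set T\<close> by (auto simp: B_set_iff)
  have y: "y s \<in> Y" if "s \<in> {0..T}" for s
    using that f1b(2) assms(14,16) unfolding Y_def y_def by blast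

  \<comment> \<open>Coordinate projections are bounded linear, hence Lipschitz, and they are bounded
    on the compact set \<open>Y \<times> K\<close>.\<close>
  have lin: "admissible_lipschitz_on (Y \<times> K) h"
    if "bounded_linear h" "h \<in> Y \<times> K \<rightarrow> ?S" for h
    unfolding admissible_lipschitz_on_def
    using that(2) bdd_lipschitz_on_linear[OF compact_imp_bounded[OF YK]
        bounded_linear_compose[OF bounded_linear_vec_nth that(1)]] by blast
  have proj: "admissible_lipschitz_on (Y \<times> K) (\<lambda>z. fst (fst z))"
    "admissible_lipschitz_on (Y \<times> K) (\<lambda>z. fst (snd z))"
    "admissible_lipschitz_on (Y \<times> K) (\<lambda>z. fst (snd (snd z)))"
    "admissible_lipschitz_on (Y \<times> K) (\<lambda>z. snd (snd (snd z)))"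
    by (intro lin bounded_linear_intros; force simp: Y_def K_def)+
  have proj': "bdd_lipschitz_on (Y \<times> K) (\<lambda>z. fst (snd (fst z)))"
    "bdd_lipschitz_on (Y \<times> K) (\<lambda>z. snd (snd (fst z)))"
    by (rule bdd_lipschitz_on_linear[OF compact_imp_bounded[OF YK]], intro bounded_linear_intros)+
  have "\<exists>L. L-lipschitz_on (Y \<times> K) (\<lambda>z. \<chi> j. rhs_in v a \<eta>0 A \<Phi> (fst (fst z))
      (fst (snd z)) (fst (snd (snd z))) (snd (snd (snd z))) j)"
      (is "\<exists>L. L-lipschitz_on _ ?h1")
    by (intro lipschitz_on_vec_lambda bdd_lipschitz_on_rhs_in[OF \<Phi> A a proj])
  then obtain L1 where L1: "L1-lipschitz_on (Y \<times> K) ?h1"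
    by (rule exE)
  have "\<exists>L. L-lipschitz_on (Y \<times> K) (\<lambda>z. \<chi> j. rhs_out v a \<eta>0 A \<Phi>
      (fst (snd (fst z))) (fst (snd z)) (fst (snd (snd z))) j)"
      (is "\<exists>L. L-lipschitz_on _ ?h2")
    by (intro lipschitz_on_vec_lambda bdd_lipschitz_on_rhs_out[OF \<Phi> A a proj'(1) proj(2,3)])
  then obtain L2 where L2: "L2-lipschitz_on (Y \<times> K) ?h2"
    by (rule exE)
  have "\<exists>L. L-lipschitz_on (Y \<times> K) (\<lambda>z. \<chi> j. rhs_out v (1 - a) \<eta>0 A \<Phi>
      (snd (snd (fst z))) (fst (snd z)) (snd (snd (snd z))) j)"
      (is "\<exists>L. L-lipschitz_on _ ?h3")
    by (intro lipschitz_on_vec_lambda bdd_lipschitz_on_rhs_out[OF \<Phi> A a' proj'(2) proj(2,4)])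
  then obtain L3 where L3: "L3-lipschitz_on (Y \<times> K) ?h3"
    by (rule exE)
  obtain L where "L-lipschitz_on (Y \<times> K) H"
    using lipschitz_on_Pair[OF L1 lipschitz_on_Pair[OF L2 L3]]
    unfolding H_def case_prod_unfold by blast
  note H = this lipschitz_on_continuous_on[OF this]

  have "\<exists>u. continuous_on {0..T} u \<and> u \<in> {0..T} \<rightarrow> K \<and>
    (\<lambda>s. H (y s, u s)) absolutely_integrable_on {0..T} \<and>
    (\<forall>t\<in>{0..T}. u t = (\<phi>1, \<phi>2, \<phi>3) + integral {0..t} (\<lambda>s. H (y s, u s)))"
  \<comment> \<open>The step size \<open>1 / (1 + \<eta>0)\<close> is the one for which each road's
    right-hand side was shown to point inward; as \<open>K\<close> is a product, the roads can be
    checked separately.\<close>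
  proof (rule convex_invariant_solution[OF less_imp_le[OF T] K, where L = L and \<kappa> = "1 / (1 + \<eta>0)"
        and ?u0.0 = "(\<phi>1, \<phi>2, \<phi>3)" and g = "\<lambda>s x. H (y s, x)"])
    show "(\<phi>1, \<phi>2, \<phi>3) \<in> K"
      using init assms(10-12) by (simp add: K_def)
    show "0 < 1 / (1 + \<eta>0)"
      using \<eta>0 by simp
  next
    fix u assume u: "continuous_on {0..T} u" "u \<in> {0..T} \<rightarrow> K"
    let ?M = "lebesgue_on {0..T}"
    have "y \<in> borel_measurable ?M"
      unfolding y_def
      by (intro borel_measurable_Pair assms(15,17)
          continuous_imp_measurable_on_sets_lebesgue f1b(1)) auto
    moreover have "u \<in> borel_measurable ?M"
      by (intro continuous_imp_measurable_on_sets_lebesgue u) auto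
    ultimately have "(\<lambda>s. (y s, u s)) \<in> borel_measurable ?M"
      by (rule borel_measurable_Pair)
    moreover have "(\<lambda>s. (y s, u s)) \<in> space ?M \<rightarrow> Y \<times> K"
      using y u(2) by auto
    \<comment> \<open>Continuity of \<open>H\<close> is known on \<open>Y \<times> K\<close> only,
      so the measurable map is first restricted to that target space and then composed with
      \<open>H\<close>.\<close>
    ultimately have "(\<lambda>s. (y s, u s)) \<in> ?M \<rightarrow>\<^sub>M restrict_space borel (Y \<times> K)"
      by (intro measurable_restrict_space2)
    from measurable_compose[OF this borel_measurable_continuous_on_restrict[OF H(2)]]
    show "(\<lambda>s. H (y s, u s)) \<in> borel_measurable ?M" .
  next
    fix s assume s: "s \<in> {0..T}"
    show "L-lipschitz_on K (\<lambda>x. H (y s, x))"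
    proof (rule lipschitz_onI)
      fix x x' assume "x \<in> K" "x' \<in> K"
      then show "dist (H (y s, x)) (H (y s, x')) \<le> L * dist x x'"
        using lipschitz_onD[OF H(1), of "(y s, x)" "(y s, x')"] y[OF s] by (simp add: dist_Pair_Pair)
    qed (rule lipschitz_on_nonneg[OF H(1)])
    fix x assume x: "x \<in> K"
    obtain f1 f2 f3 where f: "x = (f1, f2, f3)" "f1 \<in> ?S" "f2 \<in> ?S" "f3 \<in> ?S"
      using x by (auto simp: K_def)
    have b: "f1b s \<in> ?S" "\<Phi>b2 s \<in> {0..1}" "\<Phi>b3 s \<in> {0..1}"
      using y[OF s] by (simp_all add: Y_def y_def)
    show "x + (1 / (1 + \<eta>0)) *\<^sub>R H (y s, x) \<in> K"
      using rhs_in_inward[OF \<Phi> A a \<eta>0 v b(1) f(2-4)]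
        rhs_out_inward[OF \<Phi> A a \<eta>0 v b(2) f(2,3)]
        rhs_out_inward[OF \<Phi> A a' \<eta>0 v b(3) f(2,4)]
      by (auto simp: f(1) K_def H_def y_def)
  qed blast
  then obtain u where u: "continuous_on {0..T} u" "u \<in> {0..T} \<rightarrow> K"
    and int: "(\<lambda>s. H (y s, u s)) absolutely_integrable_on {0..T}"
    and eq: "\<And>t. t \<in> {0..T} \<Longrightarrow> u t = (\<phi>1, \<phi>2, \<phi>3) + integral {0..t} (\<lambda>s. H (y s, u s))"
    by blast
  define f1 f2 f3 where "f1 t = fst (u t)" and "f2 t = fst (snd (u t))" and "f3 t = snd (snd (u t))" for t
  have "f1 \<in> B_set T" "f2 \<in> B_set T" "f3 \<in> B_set T"
    unfolding f1_def f2_def f3_def B_set_iff using u(2)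
    by (auto intro!: continuous_intros u(1) simp: K_def Pi_iff mem_Times_iff)
  then have B: "(f1, f2, f3) \<in> B_set T \<times> B_set T \<times> B_set T"
    by simp
  \<comment> \<open>Here \<open>h\<close> is one of the three road projections; being bounded
    linear, it commutes with the integral.\<close>
  have component: "integral_equation T (h (\<phi>1, \<phi>2, \<phi>3) $ j) (\<lambda>s. h (H (y s, u s)) $ j)
      (\<lambda>t. h (u t) $ j)"
    if h: "bounded_linear h"
    for h :: "(real^'n::{finite,linorder}) \<times> (real^'n::{finite,linorder}) \<times> (real^'n::{finite,linorder})
        \<Rightarrow> real^'n::{finite,linorder}" and j
  proof (rule integral_equationI)
    show "(\<lambda>s. h (H (y s, u s))) absolutely_integrable_on {0..T}"
      using absolutely_integrable_linear[OF int h] by (simp add: o_def)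
    fix t assume t: "t \<in> {0..T}"
    then have "(\<lambda>s. H (y s, u s)) integrable_on {0..t}"
      using absolutely_integrable_on_subinterval[OF int, of 0 t] set_lebesgue_integral_eq_integral(1)
      by auto
    from integral_linear[OF this h]
    show "h (u t) = h (\<phi>1, \<phi>2, \<phi>3) + integral {0..t} (\<lambda>s. h (H (y s, u s)))"
      by (simp add: eq[OF t] o_def bounded_linear.linear[OF h] linear_add)
  qed
  have "mild_kinetic_solution T v a \<eta>0 A \<Phi> \<phi>1 \<phi>2 \<phi>3 f1b \<Phi>b2 \<Phi>b3 (f1, f2, f3)"
    unfolding mild_kinetic_solution_def
    using B component[OF bounded_linear_fst] component[OF bounded_linear_fst_comp[OF bounded_linear_snd]]
      component[OF bounded_linear_snd_comp[OF bounded_linear_snd]]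
    by (simp add: H_def y_def f1_def f2_def f3_def case_prod_unfold)
  with B show ?thesis
    by (rule rev_bexI)
qed

end
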